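(* Let $d\ge 2$ and let $(\mathcal{D}_n)_{n\in\mathbb{N}}$ be a sequence of finite, non-empty subsets of $\mathbb{N}^d$ such that for every fixed $c\in\mathbb{Z}^d$, $$\lim_{n\to\infty}\frac{\#((\mathcal{D}_n+c)\cap \mathcal{D}_n)}{\#\mathcal{D}_n}=1.$$ For each $n\in\mathbb{N}$, let $(X_1^{(n)},\ldots,X_d^{(n)})$ be a random vector with the uniform distribution on $\mathcal{D}_n$. Then $$\left(\lambda_p(X_1^{(n)}),\ldots,\lambda_p(X_d^{(n)})\right)_{p\in\mathcal{P}}\ \longrightarrow\ \left(\mathcal{G}_1(p),\ldots,\mathcal{G}_d(p)\right)_{p\in\mathcal{P}}$$ in distribution as $n\to\infty$, in the space $(\mathbb{R}^d)^{\infty}$ (the countable product of copies of $\mathbb{R}^d$ indexed by the primes) endowed with the product topology.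
   Context: $\mathbb{N}=\{1,2,3,\ldots\}$, $\mathbb{N}_0=\mathbb{N}\cup\{0\}$, and $\mathcal{P}$ is the set of prime numbers. For a finite set $A$, $\#A$ is its cardinality; $\mathcal{D}_n+c$ is the translate of $\mathcal{D}_n$ by $c$. For $p\in\mathcal{P}$ and $m\in\mathbb{N}$, $\lambda_p(m)$ is the exponent of $p$ in the prime factorization of $m$, so that $m=\prod_{p\in\mathcal{P}}p^{\lambda_p(m)}$. $(\mathcal{G}_1(p),\ldots,\mathcal{G}_d(p))_{p\in\mathcal{P}}$ is an array of mutually independent random variables with geometric distributions $\mathbb{P}\{\mathcal{G}_k(p)\ge j\}=p^{-j}$ for $j\in\mathbb{N}_0$, $p\in\mathcal{P}$, $k=1,\ldots,d$. *)

theory Defs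
  imports "HOL-Probability.Probability" "HOL-Computational_Algebra.Primes"
begin

text \<open>
  The primes as an index type, so that \<open>prime_index \<Rightarrow> real ^ 'd\<close> is the countable product of
  copies of $R^d$ indexed by the primes; its topology (\<open>Function_Topology\<close>) is the product topology.
\<close>
typedef prime_index = "{p::nat. prime p}"
  morphisms prime_val Abs_prime_index
  using two_is_prime_nat by blast

text \<open>
  Convergence in distribution of random elements of a topological space with its Borel
  sigma-algebra, i.e. weak convergence of their laws. The random elements may live on different
  probability spaces. (\<open>weak_conv_m\<close> in the library covers only real random variables.)
\<close>
definition converges_in_distribution ::
  "(nat \<Rightarrow> 'w measure) \<Rightarrow> (nat \<Rightarrow> 'w \<Rightarrow> 'a::topological_space) \<Rightarrow> 'v measure \<Rightarrow> ('v \<Rightarrow> 'a) \<Rightarrow> bool"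
where
  "converges_in_distribution M Y N Z \<longleftrightarrow>
     (\<forall>n. Y n \<in> borel_measurable (M n)) \<and> Z \<in> borel_measurable N \<and>
     (\<forall>f :: 'a \<Rightarrow> real. continuous_on UNIV f \<and> bounded (range f) \<longrightarrow>
        (\<lambda>n. \<integral>\<omega>. f (Y n \<omega>) \<partial>M n) \<longlonglongrightarrow> (\<integral>\<omega>. f (Z \<omega>) \<partial>N))"

end

theory Submission imports Defs begin

text \<open>
  The event that \<open>\<lambda>\<^sub>p(X\<^sub>k) \<ge> b(k,p)\<close> for finitely many pairs \<open>(k,p)\<close> says that each coordinate
  \<open>X\<^sub>k\<close> is divisible by \<open>m\<^sub>k = \<Prod>\<^sub>p p ^ b(k,p)\<close>. The vectors with this property form a lattice of
  index \<open>\<Prod>\<^sub>k m\<^sub>k\<close>, whose cosets partition \<open>\<int>\<^sup>d\<close>. Since the sets \<open>D n\<close> are asymptotically invariant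
  under every translation, all cosets carry asymptotically the same share of \<open>D n\<close>, so the lattice
  has limiting density \<open>1 / \<Prod>\<^sub>k m\<^sub>k\<close> (\<open>density_of_tile\<close>, \<open>density_of_divisibility\<close>). This is
  \<open>\<Prod> p ^ (- b(k,p))\<close>, the probability that independent geometric variables satisfy
  \<open>G\<^sub>k(p) \<ge> b(k,p)\<close> for the same pairs.

  It remains to see that convergence of these joint tail probabilities is convergence in distribution.
  Inclusion-exclusion passes from tails to cylinder probabilities
  (\<open>cylinder_convergence_of_tail_convergence\<close>). The multiplicities are then regarded as random points of
  the space \<open>'i \<Rightarrow> nat\<close> of integer arrays with countable index set, where \<open>nat\<close> is discrete. There
  every continuous \<open>f \<ge> 0\<close> is a limit from below of finite combinations of cylinder indicators, which
  gives \<open>liminf E f(U\<^sub>n) \<ge> E f(V)\<close>; applying this to \<open>B + f\<close> and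
  \<open>B - f\<close> for a bound \<open>B\<close> of \<open>\<bar>f\<bar>\<close> yields the limit
  (\<open>converges_in_distribution_of_cylinder_convergence\<close>). Finally the inclusion of integer arrays into
  the product of copies of \<open>\<real>\<^sup>d\<close> is continuous, and continuous maps preserve convergence in
  distribution.
\<close>

section \<open>Weak convergence of integer-valued processes\<close>

text \<open>
  A basic open set of the product topology restricts only finitely many coordinates, so near a given
  point a continuous function is controlled by finitely many coordinates.
\<close>

lemma continuous_function_near_finite_coordinates:
  fixes f :: "('i \<Rightarrow> 'b::topological_space) \<Rightarrow> 'c::metric_space"
  assumes "continuous_on UNIV f" and "e > 0"
  obtains F where "finite F" "\<And>z. (\<And>i. i \<in> F \<Longrightarrow> z i = y i) \<Longrightarrow> dist (f z) (f y) < e"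
proof -
  have "open (f -` ball (f y) e)"
    using assms(1) by (simp add: open_vimage)
  then have "openin (product_topology (\<lambda>i. euclidean) UNIV) (f -` ball (f y) e)"
    by (simp add: open_fun_def)
  from product_topology_open_contains_basis[OF this, of y] assms(2)
  obtain X where X: "y \<in> (\<Pi>\<^sub>E i\<in>UNIV. X i)"
      "finite {i. X i \<noteq> topspace (euclidean :: 'b topology)}" "(\<Pi>\<^sub>E i\<in>UNIV. X i) \<subseteq> f -` ball (f y) e"
    by auto
  show ?thesis
  proof (rule that[OF X(2)])
    fix z assume z: "\<And>i. i \<in> {i. X i \<noteq> topspace (euclidean :: 'b topology)} \<Longrightarrow> z i = y i"
    have "z i \<in> X i" for i
    proof (cases "X i = UNIV")
      case False
      then have "z i = y i" using z[of i] by simp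
      then show ?thesis using X(1) by (auto simp: PiE_iff)
    qed simp
    then have "z \<in> (\<Pi>\<^sub>E i\<in>UNIV. X i)" by auto
    then show "dist (f z) (f y) < e" using X(3) by (auto simp: dist_commute)
  qed
qed

lemma (in prob_space) integral_cylinder_combination:
  fixes W :: "'a \<Rightarrow> 'i \<Rightarrow> nat"
  assumes "finite F"
    and [measurable]: "\<And>i. (\<lambda>\<omega>. W \<omega> i) \<in> measurable M (count_space UNIV)"
  shows "(\<integral>\<omega>. (\<Sum>a\<in>A. c a * indicator {z. \<forall>i\<in>F. z i = a i} (W \<omega>)) \<partial>M)
       = (\<Sum>a\<in>A. c a * prob {\<omega> \<in> space M. \<forall>i\<in>F. W \<omega> i = a i})"
    and "integrable M (\<lambda>\<omega>. \<Sum>a\<in>A. c a * indicator {z. \<forall>i\<in>F. z i = a i} (W \<omega>) :: real)"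
proof -
  have S: "{\<omega> \<in> space M. \<forall>i\<in>F. W \<omega> i = a i} \<in> events" for a
    using assms(1) by measurable
  have eq: "indicator {z. \<forall>i\<in>F. z i = a i} (W \<omega>)
      = (indicator {\<omega> \<in> space M. \<forall>i\<in>F. W \<omega> i = a i} \<omega> :: real)" if "\<omega> \<in> space M" for a \<omega>
    using that by (auto simp: indicator_def)
  have int: "integrable M (\<lambda>\<omega>. c a * indicator {z. \<forall>i\<in>F. z i = a i} (W \<omega>) :: real)" for a
    using S[of a] by (subst Bochner_Integration.integrable_cong[OF refl, OF arg_cong[OF eq]])
      (auto simp: emeasure_eq_measure)
  have "(\<integral>\<omega>. c a * indicator {z. \<forall>i\<in>F. z i = a i} (W \<omega>) \<partial>M)
     = c a * prob {\<omega> \<in> space M. \<forall>i\<in>F. W \<omega> i = a i}" for a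
    using S[of a] by (subst Bochner_Integration.integral_cong[OF refl, OF arg_cong[OF eq]])
      simp_all
  with int show "(\<integral>\<omega>. (\<Sum>a\<in>A. c a * indicator {z. \<forall>i\<in>F. z i = a i} (W \<omega>)) \<partial>M)
       = (\<Sum>a\<in>A. c a * prob {\<omega> \<in> space M. \<forall>i\<in>F. W \<omega> i = a i})"
    by (subst Bochner_Integration.integral_sum) (auto simp del: integral_mult_right_zero)
  show "integrable M (\<lambda>\<omega>. \<Sum>a\<in>A. c a * indicator {z. \<forall>i\<in>F. z i = a i} (W \<omega>) :: real)"
    using int by auto
qed

lemma measurable_nat_process_borel:
  fixes W :: "'w \<Rightarrow> 'i::countable \<Rightarrow> nat"
  assumes "\<And>i. (\<lambda>\<omega>. W \<omega> i) \<in> measurable M (count_space UNIV)"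
  shows "W \<in> borel_measurable M"
  using assms by (intro measurable_coordinatewise_then_product)
    (simp add: measurable_cong_sets[OF refl sets_borel_eq_count_space])

text \<open>
  One half of the convergence of integrals, valid because \<open>f \<ge> 0\<close> can be approximated from below.
  The infimum \<open>lo m\<close> of \<open>f\<close> over the cylinder fixing the first \<open>m\<close> coordinates increases to \<open>f\<close> by
  continuity. It takes infinitely many values, so it is cut off to \<open>g m L\<close>, which vanishes unless these
  coordinates are at most \<open>L\<close>. The expectation of \<open>g m L\<close> is a finite combination of cylinder
  probabilities, and these converge.
\<close>

lemma eventually_less_integral_of_cylinder_convergence:
  fixes U :: "nat \<Rightarrow> 'w \<Rightarrow> 'i::countable \<Rightarrow> nat" and V :: "'v \<Rightarrow> 'i \<Rightarrow> nat"
    and f :: "('i \<Rightarrow> nat) \<Rightarrow> real"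
  assumes M: "\<And>n. prob_space (M n)" and N: "prob_space N"
    and U: "\<And>n i. (\<lambda>\<omega>. U n \<omega> i) \<in> measurable (M n) (count_space UNIV)"
    and V: "\<And>i. (\<lambda>\<omega>. V \<omega> i) \<in> measurable N (count_space UNIV)"
    and conv: "\<And>F a. finite F \<Longrightarrow>
      (\<lambda>n. measure (M n) {\<omega> \<in> space (M n). \<forall>i\<in>F. U n \<omega> i = a i})
        \<longlonglongrightarrow> measure N {\<omega> \<in> space N. \<forall>i\<in>F. V \<omega> i = a i}"
    and f: "continuous_on UNIV f" and f0: "\<And>y. 0 \<le> f y" and fB: "\<And>y. f y \<le> B"
    and c: "c < (\<integral>\<omega>. f (V \<omega>) \<partial>N)"
  shows "\<forall>\<^sub>F n in sequentially. c < (\<integral>\<omega>. f (U n \<omega>) \<partial>M n)"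
proof -
  interpret N: prob_space N by fact
  have fmeas: "f \<in> borel_measurable borel"
    using f by (rule borel_measurable_continuous_onI)
  have Vb: "V \<in> borel_measurable N" using V by (rule measurable_nat_process_borel)
  have Ub: "U n \<in> borel_measurable (M n)" for n using U by (rule measurable_nat_process_borel)
  define F :: "nat \<Rightarrow> 'i set" where "F m = {i. to_nat i < m}" for m
  have finF: "finite (F m)" for m
  proof -
    have "F m = to_nat -` {..<m}" by (auto simp: F_def)
    then show ?thesis by (simp add: finite_vimageI)
  qed
  define lo where "lo m a = (INF z\<in>{z. \<forall>i\<in>F m. z i = a i}. f z)" for m and a :: "'i \<Rightarrow> nat"
  have lo_le: "lo m y \<le> f y" for m y
    unfolding lo_def using f0 by (intro cINF_lower) (auto intro!: bdd_belowI[of _ 0])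
  have lo_ge: "b \<le> lo m y" if "\<And>z. (\<And>i. i \<in> F m \<Longrightarrow> z i = y i) \<Longrightarrow> b \<le> f z" for b m y
    unfolding lo_def using that by (intro cINF_greatest) auto
  have lo0: "0 \<le> lo m y" for m y
    by (intro lo_ge f0)
  have lo_B: "lo m y \<le> B" for m y
    using lo_le fB by (rule order_trans)
  have lo_lim: "(\<lambda>m. lo m y) \<longlonglongrightarrow> f y" for y
  proof (rule LIMSEQ_I)
    fix e :: real assume "e > 0"
    then obtain K where K: "finite K"
        "\<And>z. (\<And>i. i \<in> K \<Longrightarrow> z i = y i) \<Longrightarrow> dist (f z) (f y) < e / 2"
      using continuous_function_near_finite_coordinates[OF f, of "e / 2" y] by auto
    obtain m0 where m0: "\<forall>i\<in>K. to_nat i < m0"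
      using finite_nat_set_iff_bounded[of "to_nat ` K"] K(1) by auto
    have "norm (lo m y - f y) < e" if "m \<ge> m0" for m
    proof -
      have "K \<subseteq> F m" using m0 that by (auto simp: F_def intro: less_le_trans)
      have "f y - e / 2 \<le> lo m y"
      proof (rule lo_ge)
        fix z assume "\<And>i. i \<in> F m \<Longrightarrow> z i = y i"
        then have "dist (f z) (f y) < e / 2" using \<open>K \<subseteq> F m\<close> by (intro K(2)) auto
        then show "f y - e / 2 \<le> f z" unfolding dist_real_def by linarith
      qed
      then show ?thesis using lo_le[of m y] \<open>e > 0\<close> by auto
    qed
    then show "\<exists>m0. \<forall>m\<ge>m0. norm (lo m y - f y) < e" by blast
  qed
  define box where "box m L = (\<Pi>\<^sub>E i\<in>F m. {..L})" for m and L :: nat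
  define g where "g m L y = (\<Sum>a\<in>box m L. lo m a * indicator {z. \<forall>i\<in>F m. z i = a i} y)" for m L y
  have g_eq: "g m L y = (if \<forall>i\<in>F m. y i \<le> L then lo m y else 0)" for m L y
  proof -
    have "lo m a * indicator {z. \<forall>i\<in>F m. z i = a i} y = (if a = restrict y (F m) then lo m y else 0)"
      if "a \<in> box m L" for a
    proof (cases "\<forall>i\<in>F m. y i = a i")
      case True
      then have "a = restrict y (F m)" using that
        by (intro extensionalityI[of _ "F m"]) (auto simp: box_def PiE_iff)
      moreover have "lo m a = lo m y" using True by (simp add: lo_def)
      ultimately show ?thesis using True by simp
    qed auto
    then have "g m L y = (\<Sum>a\<in>box m L. if a = restrict y (F m) then lo m y else 0)"
      unfolding g_def by (intro sum.cong) auto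
    also have "\<dots> = (if restrict y (F m) \<in> box m L then lo m y else 0)"
      using finF by (simp add: box_def finite_PiE)
    also have "restrict y (F m) \<in> box m L \<longleftrightarrow> (\<forall>i\<in>F m. y i \<le> L)"
      by (auto simp: box_def PiE_iff)
    finally show ?thesis .
  qed
  have g0: "0 \<le> g m L y" and g_lo: "g m L y \<le> lo m y" for m L y
    using lo0[of m y] by (auto simp: g_eq)
  have g_B: "g m L y \<le> B" for m L y
    using g_lo lo_B by (rule order_trans)
  have g_lim: "(\<lambda>L. g m L y) \<longlonglongrightarrow> lo m y" for m y
  proof -
    obtain L0 where "\<forall>i\<in>F m. y i < L0"
      using finite_nat_set_iff_bounded[of "y ` F m"] finF by auto
    then have "\<forall>L\<ge>L0. g m L y = lo m y" by (fastforce simp: g_eq)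
    then show ?thesis
      by (intro tendsto_eventually) (auto simp: eventually_sequentially)
  qed
  have g_int: "integrable N (\<lambda>\<omega>. g m L (V \<omega>))" for m L
    unfolding g_def by (rule N.integral_cylinder_combination(2)[OF finF V])
  have lo_meas: "(\<lambda>\<omega>. lo m (V \<omega>)) \<in> borel_measurable N" for m
    by (rule borel_measurable_LIMSEQ_real[OF g_lim borel_measurable_integrable[OF g_int]])
  have fV: "(\<lambda>\<omega>. f (V \<omega>)) \<in> borel_measurable N"
    using measurable_compose[OF Vb fmeas] .
  have "(\<lambda>m. \<integral>\<omega>. lo m (V \<omega>) \<partial>N) \<longlonglongrightarrow> (\<integral>\<omega>. f (V \<omega>) \<partial>N)"
    by (rule integral_dominated_convergence[where w = "\<lambda>_. B"])
      (use fV lo_meas lo_lim lo0 lo_B in auto)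
  \<comment> \<open>The level \<open>L\<close> is chosen only after \<open>m\<close>: with \<open>L\<close> tied to \<open>m\<close>, an array whose entries grow
    quickly would lie outside all but finitely many boxes, and \<open>g\<close> would not converge to \<open>f\<close> there.\<close>
  from order_tendstoD(1)[OF this c] obtain m where m: "c < (\<integral>\<omega>. lo m (V \<omega>) \<partial>N)"
    by (auto dest: eventually_happens)
  have "(\<lambda>L. \<integral>\<omega>. g m L (V \<omega>) \<partial>N) \<longlonglongrightarrow> (\<integral>\<omega>. lo m (V \<omega>) \<partial>N)"
    by (rule integral_dominated_convergence[where w = "\<lambda>_. B"])
      (use g_int lo_meas g_lim g0 g_B in auto)
  from order_tendstoD(1)[OF this m] obtain L where L: "c < (\<integral>\<omega>. g m L (V \<omega>) \<partial>N)"
    by (auto dest: eventually_happens)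
  have "(\<lambda>n. \<integral>\<omega>. g m L (U n \<omega>) \<partial>M n) \<longlonglongrightarrow> (\<integral>\<omega>. g m L (V \<omega>) \<partial>N)"
    unfolding g_def N.integral_cylinder_combination(1)[OF finF V]
      prob_space.integral_cylinder_combination(1)[OF M finF U]
    by (intro tendsto_intros conv finF)
  then have "\<forall>\<^sub>F n in sequentially. c < (\<integral>\<omega>. g m L (U n \<omega>) \<partial>M n)"
    using L by (rule order_tendstoD)
  then show ?thesis
  proof (rule eventually_mono)
    fix n assume less: "c < (\<integral>\<omega>. g m L (U n \<omega>) \<partial>M n)"
    interpret Mn: prob_space "M n" by fact
    have "(\<integral>\<omega>. g m L (U n \<omega>) \<partial>M n) \<le> (\<integral>\<omega>. f (U n \<omega>) \<partial>M n)"
    proof (rule integral_mono)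
      show "integrable (M n) (\<lambda>\<omega>. g m L (U n \<omega>))"
        unfolding g_def by (rule Mn.integral_cylinder_combination(2)[OF finF U])
      show "integrable (M n) (\<lambda>\<omega>. f (U n \<omega>))"
        using f0 fB by (intro Mn.integrable_const_bound[where B = B] measurable_compose[OF Ub fmeas]) auto
      show "g m L (U n \<omega>) \<le> f (U n \<omega>)" for \<omega>
        using g_lo lo_le by (rule order_trans)
    qed
    with less show "c < (\<integral>\<omega>. f (U n \<omega>) \<partial>M n)" by simp
  qed
qed

text \<open>
  The lower bound for \<open>B + f\<close> bounds the integrals of \<open>f\<close> from below, the one for \<open>B - f\<close> bounds them
  from above.
\<close>

lemma converges_in_distribution_of_cylinder_convergence:
  fixes U :: "nat \<Rightarrow> 'w \<Rightarrow> 'i::countable \<Rightarrow> nat" and V :: "'v \<Rightarrow> 'i \<Rightarrow> nat"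
  assumes M: "\<And>n. prob_space (M n)" and N: "prob_space N"
    and U: "\<And>n i. (\<lambda>\<omega>. U n \<omega> i) \<in> measurable (M n) (count_space UNIV)"
    and V: "\<And>i. (\<lambda>\<omega>. V \<omega> i) \<in> measurable N (count_space UNIV)"
    and conv: "\<And>F a. finite F \<Longrightarrow>
      (\<lambda>n. measure (M n) {\<omega> \<in> space (M n). \<forall>i\<in>F. U n \<omega> i = a i})
        \<longlonglongrightarrow> measure N {\<omega> \<in> space N. \<forall>i\<in>F. V \<omega> i = a i}"
  shows "converges_in_distribution M U N V"
  unfolding converges_in_distribution_def
proof (intro conjI allI impI)
  interpret N: prob_space N by fact
  have Vb: "V \<in> borel_measurable N" using V by (rule measurable_nat_process_borel)
  have Ub: "U n \<in> borel_measurable (M n)" for n using U by (rule measurable_nat_process_borel)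
  show "U n \<in> borel_measurable (M n)" for n by (rule Ub)
  show "V \<in> borel_measurable N" by (rule Vb)
  fix f :: "('i \<Rightarrow> nat) \<Rightarrow> real"
  assume f: "continuous_on UNIV f \<and> bounded (range f)"
  then obtain B where B: "\<And>y. \<bar>f y\<bar> \<le> B" by (auto simp: bounded_iff)
  have fmeas: "f \<in> borel_measurable borel"
    using f by (intro borel_measurable_continuous_onI) auto
  have intV: "integrable N (\<lambda>\<omega>. f (V \<omega>))"
    using B by (intro N.integrable_const_bound[where B = B] measurable_compose[OF Vb fmeas]) auto
  have intU: "integrable (M n) (\<lambda>\<omega>. f (U n \<omega>))" for n
  proof -
    interpret Mn: prob_space "M n" by fact
    show ?thesis
      using B by (intro Mn.integrable_const_bound[where B = B] measurable_compose[OF Ub fmeas]) auto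
  qed
  note half = eventually_less_integral_of_cylinder_convergence[OF M N U V conv, where B = "2 * B"]
  have plus: "0 \<le> B + f y" "B + f y \<le> 2 * B" and minus: "0 \<le> B - f y" "B - f y \<le> 2 * B" for y
    using B[of y] by auto
  have V_plus: "(\<integral>\<omega>. B + f (V \<omega>) \<partial>N) = B + (\<integral>\<omega>. f (V \<omega>) \<partial>N)"
    and V_minus: "(\<integral>\<omega>. B - f (V \<omega>) \<partial>N) = B - (\<integral>\<omega>. f (V \<omega>) \<partial>N)"
    using intV by (auto simp: N.prob_space)
  have U_plus: "(\<integral>\<omega>. B + f (U n \<omega>) \<partial>M n) = B + (\<integral>\<omega>. f (U n \<omega>) \<partial>M n)"
    and U_minus: "(\<integral>\<omega>. B - f (U n \<omega>) \<partial>M n) = B - (\<integral>\<omega>. f (U n \<omega>) \<partial>M n)" for n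
  proof -
    interpret Mn: prob_space "M n" by fact
    show "(\<integral>\<omega>. B + f (U n \<omega>) \<partial>M n) = B + (\<integral>\<omega>. f (U n \<omega>) \<partial>M n)"
      and "(\<integral>\<omega>. B - f (U n \<omega>) \<partial>M n) = B - (\<integral>\<omega>. f (U n \<omega>) \<partial>M n)"
      using intU[of n] by (auto simp: Mn.prob_space)
  qed
  show "(\<lambda>n. \<integral>\<omega>. f (U n \<omega>) \<partial>M n) \<longlonglongrightarrow> (\<integral>\<omega>. f (V \<omega>) \<partial>N)"
  proof (rule order_tendstoI)
    fix c assume "c < (\<integral>\<omega>. f (V \<omega>) \<partial>N)"
    then have "\<forall>\<^sub>F n in sequentially. B + c < (\<integral>\<omega>. B + f (U n \<omega>) \<partial>M n)"
      using f plus V_plus by (intro half) (auto intro: continuous_on_add continuous_on_diff continuous_on_const)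
    then show "\<forall>\<^sub>F n in sequentially. c < (\<integral>\<omega>. f (U n \<omega>) \<partial>M n)"
      by (simp add: U_plus)
  next
    fix c assume "c > (\<integral>\<omega>. f (V \<omega>) \<partial>N)"
    then have "\<forall>\<^sub>F n in sequentially. B - c < (\<integral>\<omega>. B - f (U n \<omega>) \<partial>M n)"
      using f minus V_minus by (intro half) (auto intro: continuous_on_add continuous_on_diff continuous_on_const)
    then show "\<forall>\<^sub>F n in sequentially. c > (\<integral>\<omega>. f (U n \<omega>) \<partial>M n)"
      by (simp add: U_minus)
  qed
qed

text \<open>
  The event \<open>W\<^sub>j = a\<^sub>j\<close> is \<open>W\<^sub>j \<ge> a\<^sub>j\<close> without \<open>W\<^sub>j \<ge> a\<^sub>j + 1\<close>. This is the inductive step of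
  inclusion-exclusion, trading one equality constraint for two tail constraints.
\<close>

lemma (in prob_space) prob_one_more_equality:
  fixes W :: "'a \<Rightarrow> 'i \<Rightarrow> nat"
  assumes [measurable]: "\<And>i. (\<lambda>\<omega>. W \<omega> i) \<in> measurable M (count_space UNIV)"
    and "finite J" "finite K" "j \<notin> K"
  shows "prob {\<omega> \<in> space M. (\<forall>i\<in>insert j J. W \<omega> i = a i) \<and> (\<forall>i\<in>K. b i \<le> W \<omega> i)}
   = prob {\<omega> \<in> space M. (\<forall>i\<in>J. W \<omega> i = a i) \<and> (\<forall>i\<in>insert j K. (b(j := a j)) i \<le> W \<omega> i)}
   - prob {\<omega> \<in> space M. (\<forall>i\<in>J. W \<omega> i = a i) \<and> (\<forall>i\<in>insert j K. (b(j := Suc (a j))) i \<le> W \<omega> i)}"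
    (is "prob ?E = prob ?G - prob ?H")
proof -
  have meas: "{\<omega> \<in> space M. (\<forall>i\<in>J. W \<omega> i = a i) \<and> (\<forall>i\<in>L. b' i \<le> W \<omega> i)} \<in> events"
    if "finite L" for L b'
    using assms(2) that by measurable
  have "?G \<in> events" "?H \<in> events"
    by (rule meas, use assms(3) in simp)+
  moreover have "?H \<subseteq> ?G" using assms(4) by auto
  moreover have "?E = ?G - ?H"
    using assms(4) by (auto simp: not_less_eq_eq)
  ultimately show ?thesis by (simp add: finite_measure_Diff)
qed

lemma cylinder_convergence_of_tail_convergence:
  fixes U :: "nat \<Rightarrow> 'w \<Rightarrow> 'i \<Rightarrow> nat" and V :: "'v \<Rightarrow> 'i \<Rightarrow> nat"
  assumes M: "\<And>n. prob_space (M n)" and N: "prob_space N"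
    and U: "\<And>n i. (\<lambda>\<omega>. U n \<omega> i) \<in> measurable (M n) (count_space UNIV)"
    and V: "\<And>i. (\<lambda>\<omega>. V \<omega> i) \<in> measurable N (count_space UNIV)"
    and conv: "\<And>K b. finite K \<Longrightarrow>
      (\<lambda>n. measure (M n) {\<omega> \<in> space (M n). \<forall>i\<in>K. b i \<le> U n \<omega> i})
        \<longlonglongrightarrow> measure N {\<omega> \<in> space N. \<forall>i\<in>K. b i \<le> V \<omega> i}"
    and "finite J"
  shows "(\<lambda>n. measure (M n) {\<omega> \<in> space (M n). \<forall>i\<in>J. U n \<omega> i = a i})
           \<longlonglongrightarrow> measure N {\<omega> \<in> space N. \<forall>i\<in>J. V \<omega> i = a i}"
proof -
  \<comment> \<open>For the induction, tail constraints at coordinates outside \<open>J\<close> are allowed in addition.\<close>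
  have "(\<lambda>n. measure (M n) {\<omega> \<in> space (M n). (\<forall>i\<in>J. U n \<omega> i = a i) \<and> (\<forall>i\<in>K. b i \<le> U n \<omega> i)})
     \<longlonglongrightarrow> measure N {\<omega> \<in> space N. (\<forall>i\<in>J. V \<omega> i = a i) \<and> (\<forall>i\<in>K. b i \<le> V \<omega> i)}"
    if "finite K" "J \<inter> K = {}" for K b
    using \<open>finite J\<close> that
  proof (induction J arbitrary: K b)
    case empty
    then show ?case using conv by simp
  next
    case (insert j J)
    have "j \<notin> K" "J \<inter> insert j K = {}" using insert by auto
    then show ?case
      unfolding prob_space.prob_one_more_equality[OF M U insert(1) insert(4) \<open>j \<notin> K\<close>]
        prob_space.prob_one_more_equality[OF N V insert(1) insert(4) \<open>j \<notin> K\<close>]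
      using insert(4) by (intro tendsto_diff insert.IH) auto
  qed
  from this[of "{}"] show ?thesis by simp
qed

lemma converges_in_distribution_continuous_map:
  fixes h :: "'a::topological_space \<Rightarrow> 'b::topological_space"
  assumes "converges_in_distribution M U N V" and h: "continuous_on UNIV h"
  shows "converges_in_distribution M (\<lambda>n \<omega>. h (U n \<omega>)) N (\<lambda>\<omega>. h (V \<omega>))"
  unfolding converges_in_distribution_def
proof (intro conjI allI impI)
  have hm: "h \<in> borel_measurable borel" using h by (rule borel_measurable_continuous_onI)
  show "(\<lambda>\<omega>. h (U n \<omega>)) \<in> borel_measurable (M n)" for n
    using assms(1) by (intro measurable_compose[OF _ hm]) (simp add: converges_in_distribution_def)
  show "(\<lambda>\<omega>. h (V \<omega>)) \<in> borel_measurable N"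
    using assms(1) by (intro measurable_compose[OF _ hm]) (simp add: converges_in_distribution_def)
  fix f :: "'b \<Rightarrow> real" assume f: "continuous_on UNIV f \<and> bounded (range f)"
  have "continuous_on UNIV (\<lambda>y. f (h y))"
    using f h by (intro continuous_on_compose2[of UNIV f UNIV h]) auto
  moreover have "bounded (range (\<lambda>y. f (h y)))"
    using f by (auto intro: bounded_subset)
  ultimately show "(\<lambda>n. \<integral>\<omega>. f (h (U n \<omega>)) \<partial>M n) \<longlonglongrightarrow> (\<integral>\<omega>. f (h (V \<omega>)) \<partial>N)"
    using assms(1) unfolding converges_in_distribution_def by blast
qed

section \<open>Densities along asymptotically translation-invariant sets\<close>

text \<open>
  Translating by \<open>c\<close> carries \<open>D \<inter> A\<close> to \<open>(D + c) \<inter> (A + c)\<close>, which differs from \<open>D \<inter> (A + c)\<close> only in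
  points of \<open>D - (D + c)\<close> or \<open>(D + c) - D\<close>. These two sets have the same size, namely the right-hand
  side.
\<close>

lemma card_translate_diff_le:
  fixes D A :: "'a::ab_group_add set"
  assumes fin: "finite D"
  shows "\<bar>real (card (D \<inter> {x. x - c \<in> A})) - real (card (D \<inter> A))\<bar>
       \<le> real (card D) - real (card ((\<lambda>x. x + c) ` D \<inter> D))"
proof -
  let ?E = "(\<lambda>x. x + c) ` D" and ?B = "{x. x - c \<in> A}"
  have finE: "finite ?E" using fin by simp
  have cardE: "card ?E = card D" by (rule card_image) simp
  have "?E \<inter> ?B = (\<lambda>x. x + c) ` (D \<inter> A)" by auto
  then have EB: "card (?E \<inter> ?B) = card (D \<inter> A)" by (simp add: card_image)
  have split: "card S = card (S \<inter> T) + card (S - T)" if "finite S" for S T :: "'a set"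
    using card_Un_disjoint[of "S \<inter> T" "S - T"] that by (simp add: Int_Diff_Un Int_Diff_disjoint)
  have "card (D \<inter> ?B) = card (?E \<inter> D \<inter> ?B) + card ((D - ?E) \<inter> ?B)"
  proof -
    have "D \<inter> ?B \<inter> ?E = ?E \<inter> D \<inter> ?B" "D \<inter> ?B - ?E = (D - ?E) \<inter> ?B" by blast+
    then show ?thesis using split[of "D \<inter> ?B" ?E] fin by simp
  qed
  moreover have "card (D \<inter> A) = card (?E \<inter> D \<inter> ?B) + card ((?E - D) \<inter> ?B)"
  proof -
    have "?E \<inter> ?B \<inter> D = ?E \<inter> D \<inter> ?B" "?E \<inter> ?B - D = (?E - D) \<inter> ?B" by blast+
    then show ?thesis using split[of "?E \<inter> ?B" D] finE unfolding EB by simp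
  qed
  moreover have "card ((D - ?E) \<inter> ?B) \<le> card (D - ?E)" "card ((?E - D) \<inter> ?B) \<le> card (?E - D)"
    using fin finE by (auto intro!: card_mono)
  moreover have "card D = card (?E \<inter> D) + card (D - ?E)"
    using split[OF fin, of ?E] by (simp add: Int_commute)
  moreover have "card D = card (?E \<inter> D) + card (?E - D)"
    using split[OF finE, of D] cardE by simp
  ultimately show ?thesis by linarith
qed

text \<open>
  The translates of \<open>A\<close> by \<open>C\<close> partition the group; for a subgroup \<open>A\<close> this means that \<open>C\<close> is a
  transversal. Their densities in \<open>D n\<close> add up to 1 and become equal in the limit.
\<close>

lemma density_of_tile:
  fixes D :: "nat \<Rightarrow> 'a::ab_group_add set"
  assumes fin: "\<And>n. finite (D n)" and ne: "\<And>n. D n \<noteq> {}"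
    and inv: "\<And>c. (\<lambda>n. real (card ((\<lambda>x. x + c) ` D n \<inter> D n)) / real (card (D n))) \<longlonglongrightarrow> 1"
    and C: "finite C" and tile: "\<And>x. \<exists>!c. c \<in> C \<and> x - c \<in> A"
  shows "(\<lambda>n. real (card (D n \<inter> A)) / real (card (D n))) \<longlonglongrightarrow> 1 / real (card C)"
proof -
  define r where "r c n = real (card (D n \<inter> {x. x - c \<in> A})) / real (card (D n))" for c n
  define s where "s n = real (card (D n \<inter> A)) / real (card (D n))" for n
  have pos: "real (card (D n)) > 0" for n using fin ne by (simp add: card_gt_0_iff)
  have "(\<lambda>n. r c n - s n) \<longlonglongrightarrow> 0" for c
  proof (rule Lim_null_comparison)
    let ?t = "\<lambda>n. real (card ((\<lambda>x. x + c) ` D n \<inter> D n)) / real (card (D n))"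
    show "(\<lambda>n. 1 - ?t n) \<longlonglongrightarrow> 0" using tendsto_diff[OF tendsto_const inv[of c], of 1] by simp
    have "norm (r c n - s n) \<le> 1 - ?t n" for n
    proof -
      have "\<bar>r c n - s n\<bar>
          = \<bar>real (card (D n \<inter> {x. x - c \<in> A})) - real (card (D n \<inter> A))\<bar> / real (card (D n))"
        by (simp add: r_def s_def diff_divide_distrib[symmetric])
      also have "\<dots> \<le> (real (card (D n)) - real (card ((\<lambda>x. x + c) ` D n \<inter> D n))) / real (card (D n))"
        by (intro divide_right_mono card_translate_diff_le fin) simp
      also have "\<dots> = 1 - ?t n" using pos[of n] by (simp add: diff_divide_distrib)
      finally show ?thesis by simp
    qed
    then show "\<forall>\<^sub>F n in sequentially. norm (r c n - s n) \<le> 1 - ?t n" by simp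
  qed
  then have "(\<lambda>n. \<Sum>c\<in>C. r c n - s n) \<longlonglongrightarrow> (\<Sum>c\<in>C. 0)" by (intro tendsto_sum)
  moreover have "(\<Sum>c\<in>C. r c n - s n) = 1 - real (card C) * s n" for n
  proof -
    have "D n = (\<Union>c\<in>C. D n \<inter> {x. x - c \<in> A})" using tile by blast
    then have "card (D n) = card (\<Union>c\<in>C. D n \<inter> {x. x - c \<in> A})" by simp
    also have "\<dots> = (\<Sum>c\<in>C. card (D n \<inter> {x. x - c \<in> A}))"
      using C fin tile by (intro card_UN_disjoint) blast+
    finally have "real (card (D n)) = (\<Sum>c\<in>C. real (card (D n \<inter> {x. x - c \<in> A})))" by simp
    then have "(\<Sum>c\<in>C. r c n) = 1"
      using pos[of n] by (simp add: r_def sum_divide_distrib[symmetric])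
    then show ?thesis by (simp add: sum_subtractf)
  qed
  ultimately have "(\<lambda>n. 1 - real (card C) * s n) \<longlonglongrightarrow> 0" by simp
  from tendsto_diff[OF tendsto_const this, of 1]
  have "(\<lambda>n. real (card C) * s n) \<longlonglongrightarrow> 1" by simp
  moreover have "C \<noteq> {}" using tile by auto
  ultimately have "(\<lambda>n. (real (card C) * s n) / real (card C)) \<longlonglongrightarrow> 1 / real (card C)"
    using C by (intro tendsto_divide tendsto_const) auto
  with \<open>C \<noteq> {}\<close> C show ?thesis unfolding s_def by simp
qed

text \<open>
  The box of vectors with entries \<open>0 \<le> c\<^sub>k < m\<^sub>k\<close> is a transversal of the lattice of all \<open>x\<close> with
  \<open>m\<^sub>k\<close> dividing \<open>x\<^sub>k\<close>, by division with remainder in each coordinate.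
\<close>

lemma density_of_divisibility:
  fixes D :: "nat \<Rightarrow> (int ^ 'd) set" and m :: "'d::finite \<Rightarrow> nat"
  assumes fin: "\<And>n. finite (D n)" and ne: "\<And>n. D n \<noteq> {}"
    and inv: "\<And>c. (\<lambda>n. real (card ((\<lambda>x. x + c) ` D n \<inter> D n)) / real (card (D n))) \<longlonglongrightarrow> 1"
    and m: "\<And>k. m k > 0"
  shows "(\<lambda>n. real (card (D n \<inter> {x. \<forall>k. int (m k) dvd x $ k})) / real (card (D n)))
           \<longlonglongrightarrow> 1 / (\<Prod>k\<in>UNIV. real (m k))"
proof -
  let ?P = "\<Pi>\<^sub>E k\<in>UNIV. {0..<int (m k)}"
  define C :: "(int ^ 'd) set" where "C = vec_lambda ` ?P"
  have "inj_on vec_lambda ?P" by (rule inj_onI) (metis vec_lambda_inject UNIV_I)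
  then have card: "card C = (\<Prod>k\<in>UNIV. m k)"
    by (simp add: C_def card_image card_PiE)
  have C: "c \<in> C \<longleftrightarrow> (\<forall>k. 0 \<le> c $ k \<and> c $ k < int (m k))" for c
  proof
    assume "\<forall>k. 0 \<le> c $ k \<and> c $ k < int (m k)"
    then have "vec_nth c \<in> ?P" by auto
    then show "c \<in> C" unfolding C_def by (rule rev_image_eqI) simp
  qed (auto simp: C_def PiE_iff)
  have "(\<lambda>n. real (card (D n \<inter> {x. \<forall>k. int (m k) dvd x $ k})) / real (card (D n)))
           \<longlonglongrightarrow> 1 / real (card C)"
  proof (rule density_of_tile[OF fin ne inv])
    show "finite C" unfolding C_def by (intro finite_imageI finite_PiE) auto
    fix x :: "int ^ 'd"
    let ?r = "\<chi> k. x $ k mod int (m k)"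
    have "?r \<in> C" using m by (simp add: C)
    moreover have "\<forall>k. int (m k) dvd (x - ?r) $ k" by (simp add: minus_mod_eq_mult_div)
    moreover have "c = ?r"
      if "c \<in> C" "\<forall>k. int (m k) dvd (x - c) $ k" for c
      using that by (auto simp: C vec_eq_iff mod_eq_dvd_iff[symmetric])
    ultimately show "\<exists>!c. c \<in> C \<and> x - c \<in> {x. \<forall>k. int (m k) dvd x $ k}"
      by blast
  qed
  then show ?thesis by (simp add: card)
qed

section \<open>Prime multiplicities\<close>

instance prime_index :: countable
  by (rule countable_classI[of prime_val]) (simp add: prime_val_inject)

lemma prime_prime_val: "prime (prime_val p)"
  using prime_val by simp

text \<open>
  Powers of distinct primes are coprime, so finitely many multiplicity bounds amount to divisibility
  by one modulus. The number 0 is excluded because its \<open>multiplicity\<close> is 0 by convention although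
  every prime power divides it.
\<close>

lemma multiplicities_ge_iff_dvd:
  fixes x :: int
  assumes "x \<noteq> 0" and "finite F"
  shows "(\<forall>p\<in>F. b p \<le> multiplicity (int (prime_val p)) x)
     \<longleftrightarrow> int (\<Prod>p\<in>F. prime_val p ^ b p) dvd x"
proof -
  have "b p \<le> multiplicity (int (prime_val p)) x \<longleftrightarrow> int (prime_val p ^ b p) dvd x" for p
    using assms(1) prime_prime_val[of p] prime_gt_1_nat[OF prime_prime_val[of p]]
    by (simp add: power_dvd_iff_le_multiplicity)
  moreover have "(\<forall>p\<in>F. int (prime_val p ^ b p) dvd x) \<longleftrightarrow> int (\<Prod>p\<in>F. prime_val p ^ b p) dvd x"
    using assms(2)
  proof (induction F)
    case (insert q F)
    have "coprime (prime_val q ^ b q) (\<Prod>p\<in>F. prime_val p ^ b p)"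
      using insert(2) by (intro prod_coprime_right coprime_power_left_iff[THEN iffD2] coprime_power_right_iff[THEN iffD2] disjI1 primes_coprime prime_prime_val)
        (auto simp: prime_val_inject)
    then have "coprime (int (prime_val q ^ b q)) (int (\<Prod>p\<in>F. prime_val p ^ b p))"
      by (simp only: coprime_int_iff)
    then show ?case using insert
      by (auto simp del: of_nat_prod of_nat_power simp: of_nat_mult dest: dvd_mult_left dvd_mult_right intro: divides_mult)
  qed simp
  ultimately show ?thesis by simp
qed

theorem theorem2p1:
  fixes D :: "nat \<Rightarrow> (int ^ 'd) set"
    and M :: "nat \<Rightarrow> 'w measure"
    and X :: "nat \<Rightarrow> 'w \<Rightarrow> int ^ 'd"
    and N :: "'v measure"
    and G :: "'d \<Rightarrow> prime_index \<Rightarrow> 'v \<Rightarrow> nat"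
  assumes "CARD('d) \<ge> 2"
    and "\<And>n. finite (D n)"
    and "\<And>n. D n \<noteq> {}"
    and "\<And>n. D n \<subseteq> {x. \<forall>k. x $ k \<ge> 1}"
    and "\<And>c :: int ^ 'd.
      (\<lambda>n. real (card ((\<lambda>x. x + c) ` D n \<inter> D n)) / real (card (D n))) \<longlonglongrightarrow> 1"
    and "\<And>n. prob_space (M n)"
    and "\<And>n. X n \<in> measurable (M n) (count_space UNIV)"
    and "\<And>n. distr (M n) (count_space UNIV) (X n) = measure_pmf (pmf_of_set (D n))"
    and "prob_space N"
    and "prob_space.indep_vars N (\<lambda>_. count_space UNIV) (\<lambda>(k, p). G k p) UNIV"
    and "\<And>k p j. measure N {\<omega> \<in> space N. G k p \<omega> \<ge> j} = 1 / real (prime_val p) ^ j"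
  shows "converges_in_distribution
    M (\<lambda>n \<omega> p. \<chi> k. real (multiplicity (int (prime_val p)) (X n \<omega> $ k)))
    N (\<lambda>\<omega> p. \<chi> k. real (G k p \<omega>))"
proof -
  interpret N: prob_space N by fact
  define U where "U n \<omega> = (\<lambda>(k, p). multiplicity (int (prime_val p)) (X n \<omega> $ k))" for n \<omega>
  define V where "V \<omega> = (\<lambda>(k, p). G k p \<omega>)" for \<omega>
  define h :: "('d \<times> prime_index \<Rightarrow> nat) \<Rightarrow> prime_index \<Rightarrow> real ^ 'd"
    where "h y = (\<lambda>p. \<chi> k. real (y (k, p)))" for y
  have h: "continuous_on UNIV h"
    unfolding h_def by (intro continuous_intros continuous_on_product_coordinates)
  have U: "(\<lambda>\<omega>. U n \<omega> i) \<in> measurable (M n) (count_space UNIV)" for n i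
    unfolding U_def by (rule measurable_compose[OF assms(7)]) simp
  have V: "(\<lambda>\<omega>. V \<omega> i) \<in> measurable N (count_space UNIV)" for i
  proof -
    have "N.random_variable (count_space UNIV) ((\<lambda>(k, p). G k p) i)"
      using assms(10) unfolding N.indep_vars_def by blast
    then show ?thesis by (cases i) (simp add: V_def)
  qed
  \<comment> \<open>The limit is \<open>1 / \<Prod>\<^sub>k m\<^sub>k\<close>, with \<open>m\<^sub>k\<close> collecting the prime powers required of
    the coordinate \<open>k\<close>.\<close>
  have tails: "(\<lambda>n. measure (M n) {\<omega> \<in> space (M n). \<forall>i\<in>K. b i \<le> U n \<omega> i})
        \<longlonglongrightarrow> measure N {\<omega> \<in> space N. \<forall>i\<in>K. b i \<le> V \<omega> i}" if K: "finite K" for K b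
  proof -
    define F where "F k = {p. (k, p) \<in> K}" for k
    have finF: "finite (F k)" for k
    proof -
      have "F k = Pair k -` K" by (auto simp: F_def)
      then show ?thesis using K by (simp add: finite_vimageI inj_on_def)
    qed
    have K_Sigma: "K = Sigma UNIV F" by (auto simp: F_def)
    define m where "m k = (\<Prod>p\<in>F k. prime_val p ^ b (k, p))" for k
    have m_pos: "m k > 0" for k
      unfolding m_def using prime_gt_0_nat[OF prime_prime_val] by (intro prod_pos) auto
    have "measure (M n) {\<omega> \<in> space (M n). \<forall>i\<in>K. b i \<le> U n \<omega> i}
        = real (card (D n \<inter> {x. \<forall>k. int (m k) dvd x $ k})) / real (card (D n))" for n
    proof -
      let ?A = "{x :: int ^ 'd. \<forall>(k, p)\<in>K. b (k, p) \<le> multiplicity (int (prime_val p)) (x $ k)}"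
      have "{\<omega> \<in> space (M n). \<forall>i\<in>K. b i \<le> U n \<omega> i} = X n -` ?A \<inter> space (M n)"
        by (fastforce simp: U_def)
      then have "measure (M n) {\<omega> \<in> space (M n). \<forall>i\<in>K. b i \<le> U n \<omega> i}
          = measure (distr (M n) (count_space UNIV) (X n)) ?A"
        using assms(7) by (simp add: measure_distr)
      also have "\<dots> = real (card (D n \<inter> ?A)) / real (card (D n))"
        using assms(2,3) by (simp add: assms(8) measure_pmf_of_set)
      also have "D n \<inter> ?A = D n \<inter> {x. \<forall>k. int (m k) dvd x $ k}"
      proof -
        have "x \<in> ?A \<longleftrightarrow> (\<forall>k. int (m k) dvd x $ k)" if "x \<in> D n" for x
        proof -
          have "x $ k \<noteq> 0" for k using assms(4)[of n] that by (auto dest!: subsetD spec[of _ k])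
          then have "(\<forall>p\<in>F k. b (k, p) \<le> multiplicity (int (prime_val p)) (x $ k)) \<longleftrightarrow> int (m k) dvd x $ k" for k
            unfolding m_def using finF by (rule multiplicities_ge_iff_dvd)
          then show ?thesis by (auto simp: K_Sigma)
        qed
        then show ?thesis by blast
      qed
      finally show ?thesis .
    qed
    moreover have "measure N {\<omega> \<in> space N. \<forall>i\<in>K. b i \<le> V \<omega> i} = 1 / (\<Prod>k\<in>UNIV. real (m k))"
    proof -
      have "measure N {\<omega> \<in> space N. \<forall>i\<in>K. b i \<le> V \<omega> i}
          = (\<Prod>i\<in>K. measure N {\<omega> \<in> space N. b i \<le> V \<omega> i})"
      proof (cases "K = {}")
        case False
        have "measure N (\<Inter>i\<in>K. (case i of (k, p) \<Rightarrow> G k p) -` {b i..} \<inter> space N)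
            = (\<Prod>i\<in>K. measure N ((case i of (k, p) \<Rightarrow> G k p) -` {b i..} \<inter> space N))"
          using assms(10) False K by (intro N.indep_varsD) auto
        moreover have "(case i of (k, p) \<Rightarrow> G k p) -` {b i..} \<inter> space N
            = {\<omega> \<in> space N. b i \<le> V \<omega> i}" for i
          by (cases i) (auto simp: V_def)
        moreover have "(\<Inter>i\<in>K. {\<omega> \<in> space N. b i \<le> V \<omega> i}) = {\<omega> \<in> space N. \<forall>i\<in>K. b i \<le> V \<omega> i}"
          using False by auto
        ultimately show ?thesis by simp
      qed (simp add: N.prob_space)
      also have "\<dots> = (\<Prod>(k, p)\<in>Sigma UNIV F. 1 / real (prime_val p) ^ b (k, p))"
        unfolding K_Sigma by (intro prod.cong) (auto simp: V_def assms(11))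
      also have "\<dots> = (\<Prod>k\<in>UNIV. \<Prod>p\<in>F k. 1 / real (prime_val p) ^ b (k, p))"
        using finF by (subst prod.Sigma) auto
      also have "\<dots> = 1 / (\<Prod>k\<in>UNIV. real (m k))"
        by (simp add: m_def prod_dividef)
      finally show ?thesis .
    qed
    ultimately show ?thesis
      using density_of_divisibility[OF assms(2,3,5) m_pos] by simp
  qed
  have "converges_in_distribution M U N V"
    using cylinder_convergence_of_tail_convergence[OF assms(6,9) U V tails]
    by (intro converges_in_distribution_of_cylinder_convergence assms(6,9) U V) auto
  from converges_in_distribution_continuous_map[OF this h]
  show ?thesis by (simp add: h_def U_def V_def)
qed

end
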